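(* Let $n,k$ be integers with $3\le k\le n$ and $k\equiv 3\pmod 4$. There exists a Heffter array $H(n;k)$ if and only if $n\ge 4$ and $n\equiv 0$ or $1\pmod 4$.
   Context: For positive integers $n,k$, a (square integer) Heffter array $H(n;k)$ is an $n\times n$ array of integers, possibly with empty cells, such that: (1) each row and each column contains exactly $k$ filled cells; (2) the entries in every row and in every column sum to $0$ in $\mathbb{Z}$; (3) for every $x\in\{1,2,\ldots,nk\}$ either $x$ or $-x$ appears in the array (so, as there are exactly $nk$ filled cells, exactly one of $x,-x$ appears, exactly once). *)

theory Defs
  imports Main
begin

text \<open>
  Rows and columns are numbered from \<open>0\<close> to \<open>n - 1\<close>; \<open>None\<close> is an empty cell. Values of \<open>A\<close>
  outside this index range are irrelevant.
\<close>

definition filled :: "(nat \<Rightarrow> nat \<Rightarrow> int option) \<Rightarrow> nat \<Rightarrow> nat \<Rightarrow> bool"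
  where "filled A i j \<longleftrightarrow> A i j \<noteq> None"

text \<open>
  In the last clause the disjunction is not exclusive. Since exactly \<open>n * k\<close> cells are filled,
  the clauses together force exactly one of \<open>x\<close> and \<open>- x\<close> to appear, in exactly one cell.
\<close>

definition heffter_array :: "nat \<Rightarrow> nat \<Rightarrow> (nat \<Rightarrow> nat \<Rightarrow> int option) \<Rightarrow> bool"
  where "heffter_array n k A \<longleftrightarrow>
    (\<forall>i<n. card {j. j < n \<and> filled A i j} = k) \<and>
    (\<forall>j<n. card {i. i < n \<and> filled A i j} = k) \<and>
    (\<forall>i<n. (\<Sum>j | j < n \<and> filled A i j. the (A i j)) = 0) \<and>
    (\<forall>j<n. (\<Sum>i | i < n \<and> filled A i j. the (A i j)) = 0) \<and>
    (\<forall>x\<in>{1..int (n * k)}. \<exists>i<n. \<exists>j<n. A i j = Some x \<or> A i j = Some (- x))"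

end

theory Submission
  imports Defs
begin

text \<open>
  Necessity is a parity count: the entries have total \<open>0\<close>, while their absolute values are
  \<open>1, \<dots>, n k\<close>, so \<open>n k (n k + 1) / 2\<close> is even.

  For existence, the filled cells form \<open>k\<close> consecutive cyclic diagonals. On three of them, take a
  cyclic sequence \<open>z\<close> and a constant \<open>K\<close>, and put \<open>z\<^sub>i\<close>, \<open>- (z\<^sub>i + z\<^sub>i\<^sub>+\<^sub>1 + K)\<close>, \<open>z\<^sub>i\<^sub>+\<^sub>1 + K\<close> into row \<open>i\<close>; all
  rows and columns then sum to \<open>0\<close> whatever \<open>z\<close> is, and it remains to choose \<open>z\<close> so that the
  absolute values are \<open>1, \<dots>, 3 n\<close>. The remaining diagonals come in adjacent pairs filled with
  consecutive integers of opposite signs; the row and column sums of such a pair do not depend on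
  the position of the pair or on the integer it starts with, so an even number of pairs with
  alternating signs cancels.
\<close>

section \<open>Necessity\<close>

text \<open>The \<open>n * k\<close> filled cells must supply \<open>n * k\<close> prescribed
  absolute values, so by counting \<open>g\<close> maps \<open>S\<close> bijectively onto them.
  Modulo 2 their sum agrees with the sum of the entries, which is 0.\<close>

lemma heffter_array_imp_even_sum:
  assumes "heffter_array n k A"
  shows "even (\<Sum>{1..int (n * k)})"
proof -
  define S where "S = (SIGMA i:{..<n}. {j. j < n \<and> filled A i j})"
  define f where "f = (\<lambda>(i, j). the (A i j))"
  define g where "g = (\<lambda>c. \<bar>f c\<bar>)"
  have fin: "finite S" unfolding S_def by auto
  have card_S: "card S = n * k"
    using assms unfolding S_def heffter_array_def by (subst card_SigmaI) auto
  have sub: "{1..int (n * k)} \<subseteq> g ` S"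
  proof
    fix x assume x: "x \<in> {1..int (n * k)}"
    then obtain i j where ij: "i < n" "j < n" "A i j = Some x \<or> A i j = Some (- x)"
      using assms unfolding heffter_array_def by blast
    hence "(i, j) \<in> S" "g (i, j) = x"
      using x by (auto simp: S_def g_def f_def filled_def)
    thus "x \<in> g ` S" by force
  qed
  have "card (g ` S) \<le> card {1..int (n * k)}"
    using card_image_le[OF fin, of g] card_S by (simp del: of_nat_mult)
  hence img: "g ` S = {1..int (n * k)}"
    using card_seteq[OF finite_imageI[OF fin] sub] by simp
  have inj: "inj_on g S"
    by (rule eq_card_imp_inj_on[OF fin]) (simp add: img card_S del: of_nat_mult)
  have "sum f S = (\<Sum>i<n. \<Sum>j | j < n \<and> filled A i j. the (A i j))"
    unfolding S_def f_def by (subst sum.Sigma) auto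
  also have "\<dots> = 0"
    using assms unfolding heffter_array_def by auto
  finally have "even (sum f S)" by simp
  moreover have "even (sum g S - sum f S)"
    unfolding sum_subtractf[symmetric] by (rule dvd_sum) (simp add: g_def)
  ultimately have "even (sum f S + (sum g S - sum f S))" by (rule dvd_add)
  hence "even (sum g S)" by simp
  moreover have "sum g S = \<Sum>{1..int (n * k)}"
    using sum.reindex[OF inj, of "\<lambda>x. x"] img by simp
  ultimately show ?thesis by simp
qed

lemma double_sum_int_upto: "2 * \<Sum>{1..int N} = int (N * (N + 1))"
proof (induction N)
  case (Suc N)
  have "{1..int (Suc N)} = insert (int (Suc N)) {1..int N}" by auto
  thus ?case using Suc by (simp add: algebra_simps)
qed simp

text \<open>One of \<open>N\<close> and \<open>N + 1\<close> is odd, so 4 must divide the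
  other.\<close>

lemma heffter_array_imp_mod_4:
  assumes "heffter_array n k A"
  shows "n * k mod 4 = 0 \<or> n * k mod 4 = 3"
proof -
  define N where "N = n * k"
  obtain c where "\<Sum>{1..int N} = 2 * c"
    using heffter_array_imp_even_sum[OF assms] unfolding N_def by blast
  hence "int (N * (N + 1)) = 4 * c"
    using double_sum_int_upto[of N] by simp
  hence "(4::int) dvd int (N * (N + 1))" by simp
  hence dvd: "N * (N + 1) mod 4 = 0" by presburger
  have "N * (N + 1) mod 4 = (N mod 4) * (N mod 4 + 1) mod 4"
    by (metis mod_add_left_eq mod_mult_left_eq mod_mult_right_eq)
  moreover have "N mod 4 = 0 \<or> N mod 4 = 1 \<or> N mod 4 = 2 \<or> N mod 4 = 3" by presburger
  ultimately have "N mod 4 = 0 \<or> N mod 4 = 3" using dvd by (elim disjE) simp_all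
  thus ?thesis unfolding N_def .
qed

section \<open>Arrays filled along cyclic diagonals\<close>

text \<open>Diagonal \<open>d\<close> meets row \<open>i\<close> in column \<open>i + d\<close>
  modulo \<open>n\<close>; \<open>h\<close> is indexed by diagonal and row. The summand
  \<open>n\<close> prevents truncated subtraction for \<open>i < n\<close>.\<close>

definition diagonal_array :: "nat \<Rightarrow> nat \<Rightarrow> (nat \<Rightarrow> nat \<Rightarrow> int) \<Rightarrow> nat \<Rightarrow> nat \<Rightarrow> int option" where
  "diagonal_array n k h i j =
     (if (j + n - i) mod n < k then Some (h ((j + n - i) mod n) i) else None)"

lemma cyclic_distance_row:
  fixes i j n :: nat
  assumes "i < n" "d < n"
  shows "((i + d) mod n + n - i) mod n = d"
proof (cases "i + d < n")
  case False
  hence "(i + d) mod n = i + d - n"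
    using assms by (simp add: le_mod_geq)
  thus ?thesis using False assms by simp
qed (use assms in simp)

lemma cyclic_distance_column:
  fixes j n :: nat
  assumes "j < n" "d < n"
  shows "(j + n - (j + n - d) mod n) mod n = d"
proof (cases "d \<le> j")
  case True
  hence "(j + n - d) mod n = (j - d + n) mod n" by simp
  also have "\<dots> = j - d" using assms by simp
  finally show ?thesis using True assms by simp
next
  case False
  hence "(j + n - d) mod n = j + n - d" using assms by simp
  thus ?thesis using assms by simp
qed

lemma cyclic_add_diff:
  fixes i j n :: nat
  assumes "i < n" "j < n"
  shows "(i + (j + n - i) mod n) mod n = j"
    and "(j + n - (j + n - i) mod n) mod n = i"
  using assms by (auto simp: mod_simps cyclic_distance_column)

lemma bij_betw_cyclic_row:
  fixes n :: nat
  assumes "i < n" "k \<le> n"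
  shows "bij_betw (\<lambda>d. (i + d) mod n) {..<k} {j. j < n \<and> (j + n - i) mod n < k}"
proof (rule bij_betw_byWitness[where f' = "\<lambda>j. (j + n - i) mod n"])
  have n: "0 < n" using assms by simp
  have dist: "((i + d) mod n + n - i) mod n = d" if "d < k" for d
    using cyclic_distance_row[of i n d] that assms by simp
  show "\<forall>d\<in>{..<k}. ((i + d) mod n + n - i) mod n = d"
    using dist by blast
  show "\<forall>j\<in>{j. j < n \<and> (j + n - i) mod n < k}. (i + (j + n - i) mod n) mod n = j"
    using cyclic_add_diff[of i n j] assms cyclic_add_diff by blast
  show "(\<lambda>d. (i + d) mod n) ` {..<k} \<subseteq> {j. j < n \<and> (j + n - i) mod n < k}"
    using dist n by auto
qed auto

lemma bij_betw_cyclic_column: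
  fixes n :: nat
  assumes "j < n" "k \<le> n"
  shows "bij_betw (\<lambda>d. (j + n - d) mod n) {..<k} {i. i < n \<and> (j + n - i) mod n < k}"
proof (rule bij_betw_byWitness[where f' = "\<lambda>i. (j + n - i) mod n"])
  have n: "0 < n" using assms by simp
  have dist: "(j + n - (j + n - d) mod n) mod n = d" if "d < k" for d
    using cyclic_distance_column[of j n d] that assms by simp
  show "\<forall>d\<in>{..<k}. (j + n - (j + n - d) mod n) mod n = d"
    using dist by blast
  show "\<forall>i\<in>{i. i < n \<and> (j + n - i) mod n < k}. (j + n - (j + n - i) mod n) mod n = i"
    using cyclic_add_diff[of i n j] assms cyclic_add_diff by blast
  show "(\<lambda>d. (j + n - d) mod n) ` {..<k} \<subseteq> {i. i < n \<and> (j + n - i) mod n < k}"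
    using dist n by auto
qed auto

text \<open>Each row and each column meets every diagonal once, column \<open>j\<close> in row
  \<open>j - d\<close> modulo \<open>n\<close>, so all line sums become sums over
  \<open>d\<close>.\<close>

lemma heffter_array_diagonal_array:
  assumes "k \<le> n"
    and row: "\<And>i. i < n \<Longrightarrow> (\<Sum>d<k. h d i) = 0"
    and column: "\<And>j. j < n \<Longrightarrow> (\<Sum>d<k. h d ((j + n - d) mod n)) = 0"
    and cover: "\<And>x. x \<in> {1..int (n * k)} \<Longrightarrow> \<exists>d<k. \<exists>i<n. \<bar>h d i\<bar> = x"
  shows "heffter_array n k (diagonal_array n k h)"
proof -
  let ?A = "diagonal_array n k h"
  have filled: "filled ?A i j \<longleftrightarrow> (j + n - i) mod n < k" for i j
    by (simp add: filled_def diagonal_array_def)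
  have entry: "the (?A i j) = h ((j + n - i) mod n) i" if "(j + n - i) mod n < k" for i j
    using that by (simp add: diagonal_array_def)
  show ?thesis
    unfolding heffter_array_def filled
  proof (intro conjI allI impI ballI)
    fix i assume i: "i < n"
    note bij = bij_betw_cyclic_row[OF i \<open>k \<le> n\<close>]
    show "card {j. j < n \<and> (j + n - i) mod n < k} = k"
      using bij_betw_same_card[OF bij] by simp
    have "(\<Sum>j | j < n \<and> (j + n - i) mod n < k. the (?A i j)) = (\<Sum>d<k. h d i)"
      unfolding sum.reindex_bij_betw[OF bij, symmetric]
      by (rule sum.cong) (use i \<open>k \<le> n\<close> in \<open>auto simp: entry cyclic_distance_row\<close>)
    thus "(\<Sum>j | j < n \<and> (j + n - i) mod n < k. the (?A i j)) = 0"
      using row[OF i] by simp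
  next
    fix j assume j: "j < n"
    note bij = bij_betw_cyclic_column[OF j \<open>k \<le> n\<close>]
    show "card {i. i < n \<and> (j + n - i) mod n < k} = k"
      using bij_betw_same_card[OF bij] by simp
    have "(\<Sum>i | i < n \<and> (j + n - i) mod n < k. the (?A i j))
        = (\<Sum>d<k. h d ((j + n - d) mod n))"
      unfolding sum.reindex_bij_betw[OF bij, symmetric]
      by (rule sum.cong) (use j \<open>k \<le> n\<close> in \<open>auto simp: entry cyclic_distance_column\<close>)
    thus "(\<Sum>i | i < n \<and> (j + n - i) mod n < k. the (?A i j)) = 0"
      using column[OF j] by simp
  next
    fix x assume "x \<in> {1..int (n * k)}"
    then obtain d i where di: "d < k" "i < n" "\<bar>h d i\<bar> = x" using cover by blast
    moreover from this have "?A i ((i + d) mod n) = Some (h d i)"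
      using \<open>k \<le> n\<close> by (simp add: diagonal_array_def cyclic_distance_row)
    moreover have "(i + d) mod n < n" using di by simp
    ultimately show "\<exists>i<n. \<exists>j<n. ?A i j = Some x \<or> ?A i j = Some (- x)"
      by (metis abs_if minus_minus)
  qed
qed

section \<open>From three diagonals to \<open>k\<close> diagonals\<close>

text \<open>These are the absolute values on diagonals 0, 1 and 2. Diagonal 2 has
  \<open>z (i + 1) + K\<close> in row \<open>i\<close>; the cyclic shift to \<open>z i + K\<close>
  leaves the set unchanged.\<close>

definition core_values :: "nat \<Rightarrow> int \<Rightarrow> (nat \<Rightarrow> int) \<Rightarrow> int set" where
  "core_values n K z = (\<Union>i<n. {\<bar>z i\<bar>, \<bar>z i + K\<bar>, \<bar>z i + z (Suc i mod n) + K\<bar>})"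

lemma core_values_I:
  assumes "i < n"
  shows "\<bar>z i\<bar> \<in> core_values n K z"
    and "\<bar>z i + K\<bar> \<in> core_values n K z"
    and "\<bar>z i + z (Suc i mod n) + K\<bar> \<in> core_values n K z"
  using assms unfolding core_values_def by auto

text \<open>
  Diagonals \<open>3 + 2 p\<close> and \<open>4 + 2 p\<close> form the pair number \<open>p\<close>. Within a pair, the two cells with
  consecutive absolute values lie in the same row; \<open>t\<close> is the column of the left one.
\<close>

definition diagonal_entry :: "nat \<Rightarrow> int \<Rightarrow> (nat \<Rightarrow> int) \<Rightarrow> nat \<Rightarrow> nat \<Rightarrow> int" where
  "diagonal_entry n K z d i =
     (if d = 0 then z i
      else if d = 1 then - (z i + z (Suc i mod n) + K)
      else if d = 2 then z (Suc i mod n) + K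
      else let p = (d - 3) div 2; t = (i + 3 + 2 * p) mod n; b = int (3 * n + 2 * n * p + 2 * t)
           in (-1) ^ p * (if odd d then b + 1 else - (b + 2)))"

lemma diagonal_entry_core:
  "diagonal_entry n K z 0 i = z i"
  "diagonal_entry n K z 1 i = - (z i + z (Suc i mod n) + K)"
  "diagonal_entry n K z 2 i = z (Suc i mod n) + K"
  by (simp_all add: diagonal_entry_def)

lemma diagonal_entry_pair:
  "diagonal_entry n K z (3 + 2 * p) i =
     (-1) ^ p * int (3 * n + 2 * n * p + 2 * ((i + 3 + 2 * p) mod n) + 1)"
  "diagonal_entry n K z (4 + 2 * p) i =
     - ((-1) ^ p * int (3 * n + 2 * n * p + 2 * ((i + 3 + 2 * p) mod n) + 2))"
proof -
  have "(4 + 2 * p - 3) div 2 = p" by presburger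
  thus "diagonal_entry n K z (4 + 2 * p) i =
     - ((-1) ^ p * int (3 * n + 2 * n * p + 2 * ((i + 3 + 2 * p) mod n) + 2))"
    unfolding diagonal_entry_def Let_def by (cases "even p") simp_all
qed (simp add: diagonal_entry_def Let_def)

lemma sum_core_and_pairs:
  fixes f :: "nat \<Rightarrow> int"
  shows "(\<Sum>d<3 + 2 * q. f d) = f 0 + f 1 + f 2 + (\<Sum>p<q. f (3 + 2 * p) + f (4 + 2 * p))"
proof (induction q)
  case 0
  show ?case by (simp add: eval_nat_numeral)
next
  case (Suc q)
  have "{..<3 + 2 * Suc q} = insert (4 + 2 * q) (insert (3 + 2 * q) {..<3 + 2 * q})" by auto
  thus ?case using Suc by simp
qed

text \<open>This ties the construction to \<open>k = 3 + 4 * s\<close>, that is, to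
  \<open>2 * s\<close> pairs.\<close>

lemma sum_alternating_signs: "(\<Sum>p<2 * s. (-1) ^ p * c) = (0 :: int)"
  by (induction s) simp_all

text \<open>Pair \<open>p\<close> carries the \<open>2 * n\<close> integers following
  \<open>3 * n + 2 * n * p\<close>. Division by \<open>2 * n\<close> finds the pair; half the
  remainder is the column \<open>t\<close>, and its parity selects the left or right cell.\<close>

lemma diagonal_entry_cover_pairs:
  fixes n q v :: nat
  assumes "0 < n" "3 * n < v" "v \<le> n * (3 + 2 * q)"
  shows "\<exists>d<3 + 2 * q. \<exists>i<n. \<bar>diagonal_entry n K z d i\<bar> = int v"
proof -
  define u where "u = v - 3 * n - 1"
  define p where "p = u div (2 * n)"
  define w where "w = u mod (2 * n)"
  define t where "t = w div 2"
  \<comment> \<open>The row solves \<open>i + 3 + 2 * p = t\<close> modulo \<open>n\<close>; the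
    added multiple of \<open>n\<close> avoids truncated subtraction.\<close>
  define i where "i = (t + n * (3 + 2 * p) - (3 + 2 * p)) mod n"
  have v: "v = 3 * n + 2 * n * p + w + 1"
    using assms(2) mult_div_mod_eq[of "2 * n" u] unfolding u_def p_def w_def by linarith
  have "n * (3 + 2 * q) = 3 * n + q * (2 * n)" by (simp add: algebra_simps)
  hence "u < q * (2 * n)" using assms unfolding u_def by linarith
  hence p: "p < q" unfolding p_def by (simp add: less_mult_imp_div_less)
  have "w < 2 * n" using assms(1) unfolding w_def by simp
  hence t: "t < n" unfolding t_def by simp
  have i: "i < n" using assms(1) unfolding i_def by simp
  have le: "3 + 2 * p \<le> n * (3 + 2 * p)" using assms(1) by simp
  have "(i + 3 + 2 * p) mod n = (t + n * (3 + 2 * p) - (3 + 2 * p) + (3 + 2 * p)) mod n"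
    unfolding i_def by (simp only: add.assoc mod_add_left_eq)
  also have "\<dots> = (t + n * (3 + 2 * p)) mod n"
    using le_add_diff_inverse2[OF trans_le_add2[OF le]] by simp
  also have "\<dots> = t" using t by simp
  finally have col: "(i + 3 + 2 * p) mod n = t" .
  show ?thesis
  proof (cases "even w")
    case True
    hence "\<bar>diagonal_entry n K z (3 + 2 * p) i\<bar> = int v"
      unfolding diagonal_entry_pair col abs_mult v t_def by simp
    moreover have "3 + 2 * p < 3 + 2 * q" using p by simp
    ultimately show ?thesis using i by blast
  next
    case False
    hence "w = 2 * t + 1" unfolding t_def by simp
    hence "\<bar>diagonal_entry n K z (4 + 2 * p) i\<bar> = int v"
      unfolding diagonal_entry_pair col abs_minus_cancel abs_mult v by simp
    moreover have "4 + 2 * p < 3 + 2 * q" using p by simp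
    ultimately show ?thesis using i by blast
  qed
qed

lemma heffter_array_of_core:
  fixes n s :: nat
  assumes le: "3 + 4 * s \<le> n"
    and core: "{1..3 * int n} \<subseteq> core_values n K z"
  shows "heffter_array n (3 + 4 * s) (diagonal_array n (3 + 4 * s) (diagonal_entry n K z))"
proof (rule heffter_array_diagonal_array[OF le])
  let ?h = "diagonal_entry n K z"
  have k: "3 + 4 * s = 3 + 2 * (2 * s)" by simp
  fix i assume "i < n"
  have "?h (3 + 2 * p) i + ?h (4 + 2 * p) i = (-1) ^ p * (- 1)" for p
    unfolding diagonal_entry_pair by (simp add: algebra_simps)
  thus "(\<Sum>d<3 + 4 * s. ?h d i) = 0"
    unfolding k sum_core_and_pairs diagonal_entry_core
    by (simp only: sum_alternating_signs)
next
  let ?h = "diagonal_entry n K z"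
  have k: "3 + 4 * s = 3 + 2 * (2 * s)" by simp
  have n: "3 \<le> n" using le by simp
  fix j assume j: "j < n"
  define j' where "j' = (j + n - 1) mod n"
  have s1: "Suc j' mod n = j" unfolding j'_def using j n by (simp add: mod_simps)
  have s2: "Suc ((j + n - 2) mod n) mod n = j'"
  proof -
    have "Suc (j + n - 2) = j + n - 1" using n by simp
    thus ?thesis unfolding j'_def by (simp add: mod_simps)
  qed
  \<comment> \<open>In column \<open>j\<close> the left cell has \<open>t = j\<close>; the right
    cell has its left neighbour in column \<open>j'\<close>, so \<open>t = j'\<close>. The offset
    \<open>3 * n + 2 * n * p\<close> cancels, and only the sign depends on \<open>p\<close>, even
    across the wrap-around.\<close>
  have "?h (3 + 2 * p) ((j + n - (3 + 2 * p)) mod n) + ?h (4 + 2 * p) ((j + n - (4 + 2 * p)) mod n)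
      = (-1) ^ p * (2 * int j - 2 * int j' - 1)" if p: "p < 2 * s" for p
  proof -
    have "4 + 2 * p \<le> n" using p le by simp
    hence "((j + n - (3 + 2 * p)) mod n + 3 + 2 * p) mod n = j"
      and "((j + n - (4 + 2 * p)) mod n + 3 + 2 * p) mod n = j'"
      using j by (simp_all add: mod_simps add.assoc j'_def)
    thus ?thesis unfolding diagonal_entry_pair by (simp add: algebra_simps)
  qed
  hence "(\<Sum>p<2 * s. ?h (3 + 2 * p) ((j + n - (3 + 2 * p)) mod n)
      + ?h (4 + 2 * p) ((j + n - (4 + 2 * p)) mod n)) = 0"
    using sum_alternating_signs[of "2 * int j - 2 * int j' - 1" s] by simp
  moreover have "?h 0 ((j + n - 0) mod n) + ?h 1 ((j + n - 1) mod n) + ?h 2 ((j + n - 2) mod n) = 0"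
    unfolding diagonal_entry_core s2 j'_def[symmetric] s1 using j by simp
  ultimately show "(\<Sum>d<3 + 4 * s. ?h d ((j + n - d) mod n)) = 0"
    unfolding k sum_core_and_pairs by simp
next
  let ?h = "diagonal_entry n K z"
  have k: "3 + 4 * s = 3 + 2 * (2 * s)" by simp
  have n: "3 \<le> n" using le by simp
  fix x assume x: "x \<in> {1..int (n * (3 + 4 * s))}"
  show "\<exists>d<3 + 4 * s. \<exists>i<n. \<bar>?h d i\<bar> = x"
  proof (cases "x \<le> 3 * int n")
    case True
    hence "x \<in> core_values n K z" using core x by auto
    then obtain i where i: "i < n"
      and "x = \<bar>z i\<bar> \<or> x = \<bar>z i + K\<bar> \<or> x = \<bar>z i + z (Suc i mod n) + K\<bar>"
      unfolding core_values_def by auto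
    then consider "x = \<bar>?h 0 i\<bar>" | "x = \<bar>?h 1 i\<bar>" | "x = \<bar>z i + K\<bar>"
      unfolding diagonal_entry_core abs_minus_cancel by blast
    thus ?thesis
    proof cases
      case 3
      \<comment> \<open>\<open>z i + K\<close> stands on diagonal 2 in the cyclically preceding
        row.\<close>
      have "?h 2 ((i + n - 1) mod n) = z i + K"
        unfolding diagonal_entry_core using i by (simp add: mod_simps)
      moreover have "(i + n - 1) mod n < n" "2 < 3 + 4 * s" using i by simp_all
      ultimately show ?thesis using 3 by metis
    next
      case 1
      moreover have "0 < 3 + 4 * s" by simp
      ultimately show ?thesis using i by blast
    next
      case 2
      moreover have "1 < 3 + 4 * s" by simp
      ultimately show ?thesis using i by blast
    qed
  next
    case False
    moreover have "x \<le> int (n * (3 + 2 * (2 * s)))" using x unfolding k by simp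
    ultimately have "3 * n < nat x" "nat x \<le> n * (3 + 2 * (2 * s))" "int (nat x) = x"
      by linarith+
    thus ?thesis
      using diagonal_entry_cover_pairs[of n "nat x" "2 * s" K z] n unfolding k by simp
  qed
qed

section \<open>The three core diagonals\<close>

text \<open>
  The sequences were found by computer search. The even and the odd positions each consist of
  arithmetic progressions with step \<open>1\<close>, so that the values \<open>z\<^sub>i\<close>, \<open>z\<^sub>i + K\<close> and \<open>z\<^sub>i + z\<^sub>i\<^sub>+\<^sub>1 + K\<close> fill long
  intervals; for \<open>n = 4 m + 1\<close> three exceptional entries close the gaps. That family fails for
  \<open>m = 1\<close>, hence the separate sequence for \<open>n = 5\<close>.
\<close>

definition seq0 :: "nat \<Rightarrow> nat \<Rightarrow> int" where
  "seq0 m i = (let j = int (i div 2) in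
     if even i then 6 * int m + 1 + j
     else if i < 2 * m then j - 6 * int m
     else j - 13 * int m)"

text \<open>The values \<open>z i\<close> and \<open>z i + K\<close> cover \<open>2m+1..3m\<close>
  and \<open>5m+1..12m\<close>; the sums of neighbours fill the gaps \<open>1..2m\<close> and
  \<open>3m+1..5m\<close>.\<close>

lemma core_values_seq0:
  assumes "0 < m"
  shows "{1..3 * int (4 * m)} \<subseteq> core_values (4 * m) (3 * int m) (seq0 m)"
proof
  let ?W = "core_values (4 * m) (3 * int m) (seq0 m)"
  fix v assume v: "v \<in> {1..3 * int (4 * m)}"
  have even: "seq0 m (2 * j) = 6 * int m + 1 + int j" for j
    by (simp add: seq0_def)
  have odd: "seq0 m (2 * j + 1) = int j - (if j < m then 6 else 13) * int m" for j
    by (auto simp: seq0_def)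
  have even_in: "6 * int m + 1 + int j \<in> ?W" "9 * int m + 1 + int j \<in> ?W" if "j < 2 * m" for j
    using core_values_I(1,2)[of "2 * j" "4 * m" "seq0 m" "3 * int m"] that by (simp_all add: even add.assoc)
  have odd_in: "6 * int m - int j \<in> ?W" "3 * int m - int j \<in> ?W" if "j < m" for j
    using core_values_I(1,2)[of "2 * j + 1" "4 * m" "seq0 m" "3 * int m"] that
    by (simp_all only: odd) simp_all
  have odd_in': "13 * int m - int j \<in> ?W" "10 * int m - int j \<in> ?W" if "m \<le> j" "j < 2 * m" for j
    using core_values_I(1,2)[of "2 * j + 1" "4 * m" "seq0 m" "3 * int m"] that
    by (simp_all only: odd) simp_all
  \<comment> \<open>Both progressions rise by 1 every second position, so neighbour sums rise by 1
    at every position, apart from the drop by \<open>7 * m\<close> at position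
    \<open>2 * m\<close>.\<close>
  have step: "seq0 m i + seq0 m (Suc i) = (if i < 2 * m then int i + 1 else int i + 1 - 7 * int m)" for i
    unfolding seq0_def Let_def by auto presburger+
  have sum_in: "3 * int m + 1 + int i \<in> ?W" if "i < 2 * m" for i
    using core_values_I(3)[of i "4 * m" "seq0 m" "3 * int m"] that assms by (simp add: step; simp add: algebra_simps)
  have sum_in': "4 * int m - 1 - int i \<in> ?W" if "2 * m \<le> i" "Suc i < 4 * m" for i
    using core_values_I(3)[of i "4 * m" "seq0 m" "3 * int m"] that by (simp add: step; simp add: algebra_simps)
  have last_in: "2 * int m \<in> ?W"
  proof -
    \<comment> \<open>Writing \<open>m = Suc l\<close> puts the last position
      \<open>4 * m - 1\<close> in the form \<open>2 * j + 1\<close>; its neighbour is position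
      0.\<close>
    obtain l where l: "m = Suc l" using assms gr0_implies_Suc by blast
    hence "Suc (2 * (2 * l + 1) + 1) = 4 * m" by simp
    hence "Suc (2 * (2 * l + 1) + 1) mod (4 * m) = 2 * 0" by (simp only: mod_self mult_0_right)
    thus ?thesis
      using core_values_I(3)[of "2 * (2 * l + 1) + 1" "4 * m" "seq0 m" "3 * int m"]
      by (simp only: odd even) (simp add: l algebra_simps)
  qed
  have mem: "v \<in> ?W" if "w \<in> ?W" "w = v" for w
    using that by simp
  have "1 \<le> v \<and> v \<le> 12 * int m" using v by simp
  then consider "1 \<le> v \<and> v < 2 * int m"
    | "v = 2 * int m"
    | "2 * int m < v \<and> v \<le> 3 * int m"
    | "3 * int m < v \<and> v \<le> 5 * int m"
    | "5 * int m < v \<and> v \<le> 6 * int m"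
    | "6 * int m < v \<and> v \<le> 8 * int m"
    | "8 * int m < v \<and> v \<le> 9 * int m"
    | "9 * int m < v \<and> v \<le> 11 * int m"
    | "11 * int m < v \<and> v \<le> 12 * int m"
    by (smt (verit))
  thus "v \<in> ?W"
  proof cases
    case 1
    thus ?thesis by - (rule mem[OF sum_in'[of "nat (4 * int m - 1 - v)"]]; linarith)
  next
    case 2
    thus ?thesis using last_in by simp
  next
    case 3
    thus ?thesis by - (rule mem[OF odd_in(2)[of "nat (3 * int m - v)"]]; linarith)
  next
    case 4
    thus ?thesis by - (rule mem[OF sum_in[of "nat (v - 3 * int m - 1)"]]; linarith)
  next
    case 5
    thus ?thesis by - (rule mem[OF odd_in(1)[of "nat (6 * int m - v)"]]; linarith)
  next
    case 6
    thus ?thesis by - (rule mem[OF even_in(1)[of "nat (v - 6 * int m - 1)"]]; linarith)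
  next
    case 7
    thus ?thesis by - (rule mem[OF odd_in'(2)[of "nat (10 * int m - v)"]]; linarith)
  next
    case 8
    thus ?thesis by - (rule mem[OF even_in(2)[of "nat (v - 9 * int m - 1)"]]; linarith)
  next
    case 9
    thus ?thesis by - (rule mem[OF odd_in'(1)[of "nat (13 * int m - v)"]]; linarith)
  qed
qed

definition seq1 :: "nat \<Rightarrow> nat \<Rightarrow> int" where
  "seq1 m i = (let j = int (i div 2) in
     if even i then
       if i + 2 < 2 * m then 6 * int m + 3 + j
       else if i + 2 = 2 * m then 2 * int m + 2
       else if i = 2 * m then 2 * int m
       else j - 13 * int m - 1
     else
       if i + 2 < 2 * m then j - 6 * int m
       else if i + 1 < 4 * m then 6 * int m + 3 + j
       else 2 * int m + 1)"

text \<open>From position \<open>2 * m - 1\<close> on, the progression \<open>6 * m + 3 + j\<close>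
  continues on the odd positions and the negative entries move to the even ones. The exceptional
  entries \<open>2m+2\<close>, \<open>2m\<close>, \<open>2m+1\<close> are at positions
  \<open>2m-2\<close>, \<open>2m\<close>, \<open>4m-1\<close>.\<close>

lemma core_values_seq1:
  assumes "2 \<le> m"
  shows "{1..3 * int (4 * m + 1)} \<subseteq> core_values (4 * m + 1) (3 * int m - 1) (seq1 m)"
proof
  let ?n = "4 * m + 1"
  let ?W = "core_values ?n (3 * int m - 1) (seq1 m)"
  note core = core_values_I[of _ ?n "seq1 m" "3 * int m - 1"]
  fix v assume v: "v \<in> {1..3 * int (4 * m + 1)}"
  have even: "seq1 m (2 * j) =
      (if j + 1 < m then 6 * int m + 3 + int j else if j + 1 = m then 2 * int m + 2
       else if j = m then 2 * int m else int j - 13 * int m - 1)" for j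
    unfolding seq1_def Let_def by auto
  have odd: "seq1 m (2 * j + 1) =
      (if j + 1 < m then int j - 6 * int m else if j + 1 < 2 * m then 6 * int m + 3 + int j
       else 2 * int m + 1)" for j
    unfolding seq1_def Let_def by auto
  have even_in: "6 * int m + 3 + int j \<in> ?W" "9 * int m + 2 + int j \<in> ?W" if "j + 1 < m" for j
    using core(1,2)[of "2 * j"] that by (simp_all only: even) (simp_all add: algebra_simps)
  have even_in': "13 * int m + 1 - int j \<in> ?W" "10 * int m + 2 - int j \<in> ?W"
    if "m < j" "j \<le> 2 * m" for j
    using core(1,2)[of "2 * j"] that by (simp_all only: even) (simp_all add: algebra_simps)
  have odd_in: "6 * int m - int j \<in> ?W" "3 * int m + 1 - int j \<in> ?W" if "j + 1 < m" for j
    using core(1,2)[of "2 * j + 1"] that by (simp_all only: odd) (simp_all add: algebra_simps)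
  have odd_in': "6 * int m + 3 + int j \<in> ?W" "9 * int m + 2 + int j \<in> ?W"
    if "m \<le> j + 1" "j + 1 < 2 * m" for j
    using core(1,2)[of "2 * j + 1"] that by (simp_all only: odd) (simp_all add: algebra_simps)
  have exceptional_in:
    "2 * int m + 2 \<in> ?W" "5 * int m + 1 \<in> ?W" "2 * int m \<in> ?W" "5 * int m - 1 \<in> ?W"
    "2 * int m + 1 \<in> ?W" "5 * int m \<in> ?W"
    using core(1,2)[of "2 * (m - 1)"] core(1,2)[of "2 * m"] core(1,2)[of "2 * (2 * m - 1) + 1"] assms
    by (simp_all only: even odd) (simp_all add: algebra_simps)
  have step: "seq1 m i + seq1 m (Suc i) = int i + 3" if "i + 3 < 2 * m" for i
    using that unfolding seq1_def Let_def by auto presburger+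
  have step': "seq1 m i + seq1 m (Suc i) = int i + 2 - 7 * int m"
    if "2 * m < i" "i + 2 < 4 * m" for i
    using that unfolding seq1_def Let_def by auto presburger+
  have sum_in: "3 * int m + 2 + int i \<in> ?W" if "i + 3 < 2 * m" for i
    using core(3)[of i] that by (simp add: step; simp add: algebra_simps)
  have sum_in': "4 * int m - 1 - int i \<in> ?W" if "2 * m < i" "i + 2 < 4 * m" for i
    using core(3)[of i] that by (simp add: step'; simp add: algebra_simps)
  have sum_even_in: "\<bar>seq1 m (2 * j) + seq1 m (2 * j + 1) + (3 * int m - 1)\<bar> \<in> ?W"
    if "j < 2 * m" for j
    using core(3)[of "2 * j"] that by simp
  have sum_odd_in: "\<bar>seq1 m (2 * j + 1) + seq1 m (2 * (j + 1)) + (3 * int m - 1)\<bar> \<in> ?W"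
    if "j < 2 * m" for j
    using core(3)[of "2 * j + 1"] that by simp
  obtain l where l: "m = Suc (Suc l)"
    using assms by (metis Suc_le_D numeral_2_eq_2 Suc_le_mono)
  \<comment> \<open>These are the six neighbour sums that involve an exceptional entry.\<close>
  have exceptional_sum_in:
    "1 \<in> ?W" "12 * int m + 3 \<in> ?W" "12 * int m + 1 \<in> ?W" "12 * int m + 2 \<in> ?W"
    "6 * int m + 2 \<in> ?W" "6 * int m + 1 \<in> ?W"
    using sum_odd_in[of l] sum_even_in[of "l + 1"] sum_odd_in[of "l + 1"] sum_even_in[of "l + 2"]
      sum_even_in[of "2 * l + 3"] sum_odd_in[of "2 * l + 3"]
    by (simp_all only: even odd) (simp_all add: l algebra_simps)
  \<comment> \<open>This is the wrap-around sum; \<open>2 \<le> m\<close> makes position 0 a regular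
    entry.\<close>
  have last_in: "2 * int m - 1 \<in> ?W"
    using core(3)[of "2 * (2 * m)"] even[of "2 * m"] even[of 0] assms by simp
  have mem: "v \<in> ?W" if "w \<in> ?W" "w = v" for w
    using that by simp
  have "1 \<le> v \<and> v \<le> 12 * int m + 3" using v by simp
  then consider "v = 1"
    | "2 \<le> v \<and> v < 2 * int m - 1"
    | "v = 2 * int m - 1"
    | "v = 2 * int m \<or> v = 2 * int m + 1 \<or> v = 2 * int m + 2"
    | "2 * int m + 2 < v \<and> v \<le> 3 * int m + 1"
    | "3 * int m + 1 < v \<and> v < 5 * int m - 1"
    | "v = 5 * int m - 1 \<or> v = 5 * int m \<or> v = 5 * int m + 1"
    | "5 * int m + 1 < v \<and> v \<le> 6 * int m"
    | "v = 6 * int m + 1 \<or> v = 6 * int m + 2"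
    | "6 * int m + 2 < v \<and> v \<le> 7 * int m + 1"
    | "7 * int m + 1 < v \<and> v \<le> 8 * int m + 1"
    | "8 * int m + 1 < v \<and> v \<le> 9 * int m + 1"
    | "9 * int m + 1 < v \<and> v \<le> 10 * int m"
    | "10 * int m < v \<and> v \<le> 11 * int m"
    | "11 * int m < v \<and> v \<le> 12 * int m"
    | "v = 12 * int m + 1 \<or> v = 12 * int m + 2 \<or> v = 12 * int m + 3"
    by (smt (verit))
  thus "v \<in> ?W"
  proof cases
    case 1
    thus ?thesis using exceptional_sum_in by simp
  next
    case 2
    thus ?thesis by - (rule mem[OF sum_in'[of "nat (4 * int m - 1 - v)"]]; linarith)
  next
    case 3
    thus ?thesis using last_in by simp
  next
    case 4
    thus ?thesis using exceptional_in by auto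
  next
    case 5
    thus ?thesis by - (rule mem[OF odd_in(2)[of "nat (3 * int m + 1 - v)"]]; linarith)
  next
    case 6
    thus ?thesis by - (rule mem[OF sum_in[of "nat (v - 3 * int m - 2)"]]; linarith)
  next
    case 7
    thus ?thesis using exceptional_in by auto
  next
    case 8
    thus ?thesis by - (rule mem[OF odd_in(1)[of "nat (6 * int m - v)"]]; linarith)
  next
    case 9
    thus ?thesis using exceptional_sum_in by auto
  next
    case 10
    thus ?thesis by - (rule mem[OF even_in(1)[of "nat (v - 6 * int m - 3)"]]; linarith)
  next
    case 11
    thus ?thesis by - (rule mem[OF odd_in'(1)[of "nat (v - 6 * int m - 3)"]]; linarith)
  next
    case 12
    thus ?thesis by - (rule mem[OF even_in'(2)[of "nat (10 * int m + 2 - v)"]]; linarith)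
  next
    case 13
    thus ?thesis by - (rule mem[OF even_in(2)[of "nat (v - 9 * int m - 2)"]]; linarith)
  next
    case 14
    thus ?thesis by - (rule mem[OF odd_in'(2)[of "nat (v - 9 * int m - 2)"]]; linarith)
  next
    case 15
    thus ?thesis by - (rule mem[OF even_in'(1)[of "nat (13 * int m + 1 - v)"]]; linarith)
  next
    case 16
    thus ?thesis using exceptional_sum_in by auto
  qed
qed

lemma core_values_5: "{1..3 * int 5} \<subseteq> core_values 5 3 (\<lambda>i. [2, 9, 3, - 10, 8] ! i)"
proof -
  have "{..<5} = {0, 1, 2, 3, 4 :: nat}" by auto
  \<comment> \<open>The values are listed in triples, one for each position.\<close>
  hence "core_values 5 3 (\<lambda>i. [2, 9, 3, - 10, 8] ! i)
      = {2, 5, 14, 9, 12, 15, 3, 6, 4, 10, 7, 1, 8, 11, 13}"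
    unfolding core_values_def by (simp add: insert_commute)
  thus ?thesis by (simp add: set_upto[symmetric] upto_rec1 del: set_upto)
qed

theorem theorem3p14:
  fixes n k :: nat
  assumes "3 \<le> k" and "k \<le> n" and "k mod 4 = 3"
  shows "(\<exists>A. heffter_array n k A) \<longleftrightarrow> n \<ge> 4 \<and> (n mod 4 = 0 \<or> n mod 4 = 1)"
proof
  assume "\<exists>A. heffter_array n k A"
  hence "n * k mod 4 = 0 \<or> n * k mod 4 = 3"
    using heffter_array_imp_mod_4 by blast
  \<comment> \<open>Since \<open>k\<close> is 3 modulo 4, the product is congruent to
    \<open>- n\<close>, which leaves only residues 0 and 1 for \<open>n\<close>.\<close>
  hence "(n mod 4) * 3 mod 4 = 0 \<or> (n mod 4) * 3 mod 4 = 3"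
    unfolding mod_mult_eq[of n 4 k, symmetric] assms(3) .
  moreover have "n mod 4 = 0 \<or> n mod 4 = 1 \<or> n mod 4 = 2 \<or> n mod 4 = 3" by presburger
  ultimately have "n mod 4 = 0 \<or> n mod 4 = 1" by (elim disjE) simp_all
  moreover from this have "n \<noteq> 3" by auto
  ultimately show "n \<ge> 4 \<and> (n mod 4 = 0 \<or> n mod 4 = 1)" using assms by auto
next
  assume n: "n \<ge> 4 \<and> (n mod 4 = 0 \<or> n mod 4 = 1)"
  define m where "m = n div 4"
  have "0 < m" using n unfolding m_def by auto
  have "n = 4 * m \<or> n = 4 * m + 1" using n unfolding m_def by presburger
  then consider "n = 4 * m" | "n = 4 * m + 1" "2 \<le> m" | "n = 5" using \<open>0 < m\<close> by fastforce
  then obtain K z where core: "{1..3 * int n} \<subseteq> core_values n K z"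
  proof cases
    case 1
    thus ?thesis using core_values_seq0 \<open>0 < m\<close> that by blast
  next
    case 2
    thus ?thesis using core_values_seq1 that by blast
  next
    case 3
    thus ?thesis using core_values_5 that by blast
  qed
  have "k = 3 + 4 * (k div 4)" using assms(3) by presburger
  thus "\<exists>A. heffter_array n k A"
    using heffter_array_of_core[OF _ core, of "k div 4"] assms(2) by auto
qed

end
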